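(* Let $\{\mathbf n=\mathbf v\oplus\mathbf z,\langle\,,\rangle,\mathbf J_Z\}$ be a metric 2-step nilpotent Lie algebra, let $\sigma$ be an involutive orthogonal transformation of $\mathbf v$ commuting with every $\mathbf J_Z$, $Z\in\mathbf z$, and let $\mathbf n_\sigma=\{\mathbf v\oplus\mathbf z,\langle\,,\rangle,\sigma\mathbf J_Z\}$ be the $\sigma$-deformed Lie algebra. Then the corresponding left-invariant metrics $g$ and $g^\sigma$ have identical Ricci curvature at the origin, i.e. their Ricci tensors at the origin coincide as bilinear forms on $\mathbf v\oplus\mathbf z$.
   Context: A metric 2-step nilpotent Lie algebra is a system $\{\mathbf n=\mathbf v\oplus\mathbf z,\langle\,,\rangle,\mathbf J_Z\}$ (finite-dimensional, real), where $\mathbf z=[\mathbf n,\mathbf n]$ is the center, $\langle\,,\rangle$ is an inner product with $\mathbf v\perp\mathbf z$, and the injective linear map $\mathbf J:\mathbf z\to \mathrm{End}(\mathbf v)$ (with skew-symmetric values) is given by $\langle \mathbf J_Z(X),Y\rangle=\langle[X,Y],Z\rangle$; conversely the bracket is determined by $\mathbf J$. The corresponding Lie group is $\mathbf v\oplus\mathbf z$ with product $(X,Z)(X',Z')=(X+X',Z+Z'+\tfrac12[X,X'])$, with the left-invariant metric extending $\langle\,,\rangle$; the tangent space at the origin is identified with $\mathbf v\oplus\mathbf z$ for both groups. *)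

theory Defs
  imports "HOL-Analysis.Analysis"
begin

section \<open>Riemannian metrics on a Euclidean space\<close>

text \<open>
  A Riemannian metric on the manifold \<open>'a\<close> (with its global linear chart, so that every tangent
  space is identified with \<open>'a\<close>) is a function \<open>g\<close> with \<open>g p u w\<close> the inner product of the tangent
  vectors \<open>u\<close>, \<open>w\<close> at \<open>p\<close>.  Vector fields are functions \<open>'a \<Rightarrow> 'a\<close>.
\<close>

text \<open>
  Christoffel symbols: \<open>g\<^sub>p(\<Gamma>\<^sub>p(u,w), y) = 1/2 (D\<^sub>u g(w,y) + D\<^sub>w g(u,y) - D\<^sub>y g(u,w))\<close>.
\<close>

definition christoffel ::
    "('a::euclidean_space \<Rightarrow> 'a \<Rightarrow> 'a \<Rightarrow> real) \<Rightarrow> 'a \<Rightarrow> 'a \<Rightarrow> 'a \<Rightarrow> 'a" where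
  "christoffel g p u w = (THE x. \<forall>y. g p x y =
     (frechet_derivative (\<lambda>q. g q w y) (at p) u
      + frechet_derivative (\<lambda>q. g q u y) (at p) w
      - frechet_derivative (\<lambda>q. g q u w) (at p) y) / 2)"

definition levi_civita ::
    "('a::euclidean_space \<Rightarrow> 'a \<Rightarrow> 'a \<Rightarrow> real) \<Rightarrow> ('a \<Rightarrow> 'a) \<Rightarrow> ('a \<Rightarrow> 'a) \<Rightarrow> 'a \<Rightarrow> 'a" where
  "levi_civita g U W p = frechet_derivative W (at p) (U p) + christoffel g p (U p) (W p)"

text \<open>
  \<open>R(u,v)w = \<nabla>\<^sub>U \<nabla>\<^sub>V W - \<nabla>\<^sub>V \<nabla>\<^sub>U W - \<nabla>\<^sub>[\<^sub>U\<^sub>,\<^sub>V\<^sub>] W\<close>, computed at \<open>p\<close> with the constant (coordinate) vector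
  fields extending \<open>u\<close>, \<open>v\<close>, \<open>w\<close>; these commute, so the last term vanishes.
\<close>

definition riemann_curvature ::
    "('a::euclidean_space \<Rightarrow> 'a \<Rightarrow> 'a \<Rightarrow> real) \<Rightarrow> 'a \<Rightarrow> 'a \<Rightarrow> 'a \<Rightarrow> 'a \<Rightarrow> 'a" where
  "riemann_curvature g p u v w =
     levi_civita g (\<lambda>_. u) (levi_civita g (\<lambda>_. v) (\<lambda>_. w)) p
     - levi_civita g (\<lambda>_. v) (levi_civita g (\<lambda>_. u) (\<lambda>_. w)) p"

text \<open>
  \<open>Ric(v,w)\<close> is the trace of the endomorphism \<open>u \<mapsto> R(u,v)w\<close>.  The trace is written in the
  standard basis of \<open>'a\<close>; it does not depend on \<open>g\<close> or on the choice of basis.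
\<close>

definition ricci ::
    "('a::euclidean_space \<Rightarrow> 'a \<Rightarrow> 'a \<Rightarrow> real) \<Rightarrow> 'a \<Rightarrow> 'a \<Rightarrow> 'a \<Rightarrow> real" where
  "ricci g p v w = (\<Sum>b\<in>Basis. riemann_curvature g p b v w \<bullet> b)"


section \<open>Metric 2-step nilpotent Lie algebras\<close>

text \<open>
  The algebra \<open>v \<oplus> z\<close> is the product type \<open>'v \<times> 'z\<close>, whose inner product makes the two factors
  orthogonal.  The map \<open>J\<close> determines the bracket \<open>v \<times> v \<rightarrow> z\<close> by \<open>\<langle>J\<^sub>Z X, Y\<rangle> = \<langle>[X,Y], Z\<rangle>\<close>, i.e.
  \<open>Y \<mapsto> [X,Y]\<close> is the adjoint of \<open>Z \<mapsto> J\<^sub>Z X\<close> (see \<open>inner_vbracket\<close>).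
\<close>

definition vbracket ::
    "('z::euclidean_space \<Rightarrow> 'v::euclidean_space \<Rightarrow> 'v) \<Rightarrow> 'v \<Rightarrow> 'v \<Rightarrow> 'z" where
  "vbracket J X = adjoint (\<lambda>Z. J Z X)"

definition nbracket ::
    "('z::euclidean_space \<Rightarrow> 'v::euclidean_space \<Rightarrow> 'v) \<Rightarrow> 'v \<times> 'z \<Rightarrow> 'v \<times> 'z \<Rightarrow> 'v \<times> 'z" where
  "nbracket J m n = (0, vbracket J (fst m) (fst n))"

text \<open>
  The last two conjuncts say that the centre and the derived algebra both equal \<open>z = {0} \<times> UNIV\<close>.
\<close>

definition metric_two_step_nilpotent ::
    "('z::euclidean_space \<Rightarrow> 'v::euclidean_space \<Rightarrow> 'v) \<Rightarrow> bool" where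
  "metric_two_step_nilpotent J \<longleftrightarrow>
     bilinear J \<and>
     (\<forall>Z X Y. J Z X \<bullet> Y = - (X \<bullet> J Z Y)) \<and>
     inj J \<and>
     {n. \<forall>m. nbracket J n m = 0} = {0} \<times> UNIV \<and>
     span {nbracket J m n | m n. True} = {0} \<times> UNIV"

definition deform ::
    "('v \<Rightarrow> 'v) \<Rightarrow> ('z::euclidean_space \<Rightarrow> 'v::euclidean_space \<Rightarrow> 'v) \<Rightarrow> 'z \<Rightarrow> 'v \<Rightarrow> 'v" where
  "deform \<sigma> J = (\<lambda>Z. \<sigma> \<circ> J Z)"


section \<open>The group and its left-invariant metric\<close>

definition gmult ::
    "('z::euclidean_space \<Rightarrow> 'v::euclidean_space \<Rightarrow> 'v) \<Rightarrow> 'v \<times> 'z \<Rightarrow> 'v \<times> 'z \<Rightarrow> 'v \<times> 'z" where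
  "gmult J p q = (fst p + fst q, snd p + snd q + (1/2) *\<^sub>R vbracket J (fst p) (fst q))"

text \<open>
  Tangent vectors at \<open>p\<close> are moved to the origin by the differential of the left translation by
  the inverse of \<open>p\<close>, which is \<open>- p\<close>.
\<close>

definition left_invariant_metric ::
    "('z::euclidean_space \<Rightarrow> 'v::euclidean_space \<Rightarrow> 'v) \<Rightarrow> 'v \<times> 'z \<Rightarrow> 'v \<times> 'z \<Rightarrow> 'v \<times> 'z \<Rightarrow> real" where
  "left_invariant_metric J p u w =
     frechet_derivative (gmult J (- p)) (at p) u \<bullet> frechet_derivative (gmult J (- p)) (at p) w"


section \<open>Basic facts\<close>

text \<open>
  For a differentiable Riemannian metric the description in \<open>christoffel\<close> has a unique solution,
  and the resulting connection is the torsion-free metric one.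
\<close>

lemma christoffel_works:
  fixes g :: "'a::euclidean_space \<Rightarrow> 'a \<Rightarrow> 'a \<Rightarrow> real"
  assumes bil: "\<And>q. bilinear (g q)"
    and pos: "\<And>u. u \<noteq> 0 \<Longrightarrow> g p u u > 0"
    and diff: "\<And>u w. (\<lambda>q. g q u w) differentiable (at p)"
  shows "g p (christoffel g p u w) y =
     (frechet_derivative (\<lambda>q. g q w y) (at p) u
      + frechet_derivative (\<lambda>q. g q u y) (at p) w
      - frechet_derivative (\<lambda>q. g q u w) (at p) y) / 2"
proof -
  define D where "D u w = frechet_derivative (\<lambda>q. g q u w) (at p)" for u w
  have D: "((\<lambda>q. g q u w) has_derivative D u w) (at p)" for u w
    unfolding D_def using diff frechet_derivative_works by blast
  have Dadd: "D a (x + y) v = D a x v + D a y v" for a x y v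
    using fun_cong[OF frechet_derivative_at[OF has_derivative_add[OF D[of a x] D[of a y]]], of v]
    by (simp add: D_def bilinear_radd[OF bil])
  have Dscale: "D a (c *\<^sub>R x) v = c * D a x v" for a c x v
    using fun_cong[OF frechet_derivative_at[OF has_derivative_mult_right[OF D[of a x], of c]], of v]
    by (simp add: D_def bilinear_rmul[OF bil])
  have DL: "linear (D a x)" for a x
    using D has_derivative_linear by blast
  define \<phi> where "\<phi> y = (D w y u + D u y w - D u w y) / 2" for y
  have \<phi>: "linear \<phi>"
    by (rule linearI)
      (simp_all add: \<phi>_def Dadd Dscale linear_add[OF DL] linear_scale[OF DL] algebra_simps
        add_divide_distrib diff_divide_distrib)
  have lin: "linear (g p x)" for x using bil by (simp add: bilinear_def)
  define T where "T x = (\<Sum>b\<in>Basis. g p x b *\<^sub>R b)" for x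
  have T: "T x \<bullet> y = g p x y" for x y
    unfolding T_def inner_sum_left inner_scaleR_left
    by (subst (3) euclidean_representation[symmetric])
      (simp add: linear_sum[OF lin] linear_scale[OF lin] inner_commute mult.commute)
  have "linear T"
    by (rule linearI)
      (simp_all add: T_def bilinear_ladd[OF bil] bilinear_lmul[OF bil] scaleR_add_left
        sum.distrib scaleR_sum_right)
  moreover have "inj T"
  proof -
    have "x = 0" if "T x = 0" for x
      using T[of x x] pos[of x] that by force
    with \<open>linear T\<close> show ?thesis by (simp add: linear_injective_0)
  qed
  ultimately have "surj T" by (rule linear_injective_imp_surjective) simp_all
  then obtain x where "T x = (\<Sum>b\<in>Basis. \<phi> b *\<^sub>R b)" by (metis surjD)
  moreover have "(\<Sum>b\<in>Basis. \<phi> b *\<^sub>R b) \<bullet> y = \<phi> y" for y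
    unfolding inner_sum_left inner_scaleR_left
    by (subst (3) euclidean_representation[symmetric])
      (simp add: linear_sum[OF \<phi>] linear_scale[OF \<phi>] inner_commute mult.commute)
  ultimately have x: "\<forall>y. g p x y = \<phi> y" by (metis T)
  have "(THE x. \<forall>y. g p x y = \<phi> y) = x"
  proof (rule the_equality)
    show "x' = x" if "\<forall>y. g p x' y = \<phi> y" for x'
      using that x T \<open>inj T\<close> by (metis injD vector_eq_rdot)
  qed (fact x)
  then have "christoffel g p u w = x"
    by (simp only: christoffel_def \<phi>_def D_def)
  then show ?thesis using x by (simp add: \<phi>_def D_def)
qed

lemma
  fixes g :: "'a::euclidean_space \<Rightarrow> 'a \<Rightarrow> 'a \<Rightarrow> real"
  assumes bil: "\<And>q. bilinear (g q)"
    and sym: "\<And>q u w. g q u w = g q w u"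
    and pos: "\<And>u. u \<noteq> 0 \<Longrightarrow> g p u u > 0"
    and diff: "\<And>u w. (\<lambda>q. g q u w) differentiable (at p)"
  shows christoffel_torsion_free: "christoffel g p u w = christoffel g p w u"
    and christoffel_metric: "frechet_derivative (\<lambda>q. g q v w) (at p) u =
      g p (christoffel g p u v) w + g p v (christoffel g p u w)"
proof -
  have C: "g p (christoffel g p u w) y =
     (frechet_derivative (\<lambda>q. g q w y) (at p) u
      + frechet_derivative (\<lambda>q. g q u y) (at p) w
      - frechet_derivative (\<lambda>q. g q u w) (at p) y) / 2" for u w y
    using bil pos diff by (rule christoffel_works)
  have "(\<lambda>q. g q u w) = (\<lambda>q. g q w u)" for u w using sym by blast
  note D = arg_cong[where f = "\<lambda>f. frechet_derivative f (at p)", OF this]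
  show "christoffel g p u w = christoffel g p w u"
    unfolding christoffel_def by (subst (3) D) (simp add: add.commute)
  show "frechet_derivative (\<lambda>q. g q v w) (at p) u =
      g p (christoffel g p u v) w + g p v (christoffel g p u w)"
  proof -
    have "g p v (christoffel g p u w) = g p (christoffel g p u w) v" by (rule sym)
    then show ?thesis
      using C[of u v w] C[of u w v] fun_cong[OF D[of u v], of w] fun_cong[OF D[of u w], of v]
        fun_cong[OF D[of v w], of u]
      by argo
  qed
qed

lemma inner_vbracket:
  assumes "bilinear J"
  shows "vbracket J X Y \<bullet> Z = J Z X \<bullet> Y"
  using assms adjoint_works[of "\<lambda>Z. J Z X" Z Y]
  by (simp add: vbracket_def bilinear_def inner_commute)

lemma bilinear_vbracket:
  assumes "bilinear J"
  shows "bilinear (vbracket J)"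
proof -
  have J: "J Z (x + y) = J Z x + J Z y" "J Z (c *\<^sub>R x) = c *\<^sub>R J Z x" for Z x y c
    using bilinear_radd[OF assms] bilinear_rmul[OF assms] by auto
  have eqI: "W = W'" if "\<And>Z. W \<bullet> Z = W' \<bullet> Z" for W W' :: 'a
    using that by (metis vector_eq_rdot)
  show ?thesis
    unfolding bilinear_def
    by (intro conjI allI linearI; rule eqI; simp only: inner_vbracket[OF assms] J
          inner_add_left inner_add_right inner_scaleR_left inner_scaleR_right)
qed

lemma vbracket_antisym:
  assumes "metric_two_step_nilpotent J"
  shows "vbracket J X Y = - vbracket J Y X"
proof -
  have B: "bilinear J" and S: "J Z X \<bullet> Y = - (X \<bullet> J Z Y)" for Z X Y
    using assms by (auto simp: metric_two_step_nilpotent_def)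
  have "vbracket J X Y \<bullet> Z = - vbracket J Y X \<bullet> Z" for Z
    using S[of Z X Y] by (simp add: inner_vbracket[OF B] inner_commute[of X])
  then show ?thesis by (metis vector_eq_rdot)
qed

lemma gmult_assoc:
  assumes "metric_two_step_nilpotent J"
  shows "gmult J (gmult J p q) r = gmult J p (gmult J q r)"
proof -
  have B: "bilinear (vbracket J)"
    using assms bilinear_vbracket by (auto simp: metric_two_step_nilpotent_def)
  show ?thesis
    by (simp add: gmult_def bilinear_ladd[OF B] bilinear_radd[OF B] scaleR_add_right)
qed

lemma gmult_inverse:
  assumes "metric_two_step_nilpotent J"
  shows "gmult J (- p) p = 0" "gmult J p (- p) = 0"
proof -
  have B: "bilinear (vbracket J)"
    using assms bilinear_vbracket by (auto simp: metric_two_step_nilpotent_def)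
  have "2 *\<^sub>R vbracket J X X = 0" for X
    using vbracket_antisym[OF assms, of X X] unfolding scaleR_2 by (metis ab_left_minus)
  then have "vbracket J X X = 0" for X by simp
  then show "gmult J (- p) p = 0" "gmult J p (- p) = 0"
    by (simp_all add: gmult_def bilinear_lneg[OF B] bilinear_rneg[OF B] zero_prod_def)
qed

lemma gmult_has_derivative:
  assumes "bilinear J"
  shows "(gmult J p has_derivative
            (\<lambda>u. (fst u, snd u + (1/2) *\<^sub>R vbracket J (fst p) (fst u)))) (at q)"
proof -
  have "linear (vbracket J (fst p))"
    using bilinear_vbracket[OF assms] by (simp add: bilinear_def)
  then have "bounded_linear (vbracket J (fst p))"
    by (simp add: linear_conv_bounded_linear)
  then have D: "((\<lambda>x. vbracket J (fst p) (fst x)) has_derivative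
          (\<lambda>u. vbracket J (fst p) (fst u))) (at q)"
    by (rule bounded_linear.has_derivative) (auto intro!: derivative_eq_intros)
  have "gmult J p = (\<lambda>x. (fst p + fst x, snd p + snd x + (1/2) *\<^sub>R vbracket J (fst p) (fst x)))"
    by (auto simp: gmult_def)
  then show ?thesis
    by (auto intro!: derivative_eq_intros D)
qed

lemma left_invariant_metric_eq:
  assumes "bilinear J"
  shows "left_invariant_metric J p u w =
     fst u \<bullet> fst w + (snd u - (1/2) *\<^sub>R vbracket J (fst p) (fst u))
                     \<bullet> (snd w - (1/2) *\<^sub>R vbracket J (fst p) (fst w))"
  using bilinear_lneg[OF bilinear_vbracket[OF assms]]
  unfolding left_invariant_metric_def
    frechet_derivative_at[OF gmult_has_derivative[OF assms], symmetric]
  by (simp add: inner_prod_def)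

lemma left_invariant_metric_origin:
  assumes "bilinear J"
  shows "left_invariant_metric J 0 u w = u \<bullet> w"
  using bilinear_lzero[OF bilinear_vbracket[OF assms]]
  by (simp add: left_invariant_metric_eq[OF assms] inner_prod_def)

lemma left_invariant_metric_left_invariant:
  assumes "metric_two_step_nilpotent J"
  shows "left_invariant_metric J (gmult J a p)
           (frechet_derivative (gmult J a) (at p) u) (frechet_derivative (gmult J a) (at p) w)
         = left_invariant_metric J p u w"
proof -
  have J: "bilinear J" using assms by (simp add: metric_two_step_nilpotent_def)
  note B = bilinear_vbracket[OF J]
  show ?thesis
    unfolding left_invariant_metric_eq[OF J]
      frechet_derivative_at[OF gmult_has_derivative[OF J], symmetric]
    by (simp add: gmult_def bilinear_ladd[OF B] scaleR_add_right)
qed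

lemma vbracket_deform:
  assumes "bilinear J" "orthogonal_transformation \<sigma>" "\<sigma> \<circ> \<sigma> = id"
  shows "bilinear (deform \<sigma> J)" "vbracket (deform \<sigma> J) X Y = vbracket J X (\<sigma> Y)"
proof -
  have L: "linear \<sigma>" using assms(2) by (rule orthogonal_transformation_linear)
  show B: "bilinear (deform \<sigma> J)"
    using assms(1) L
    by (auto simp: bilinear_def deform_def o_def intro: linear_compose[unfolded o_def])
  have sym: "\<sigma> x \<bullet> y = x \<bullet> \<sigma> y" for x y
  proof -
    have "\<sigma> x \<bullet> \<sigma> (\<sigma> y) = x \<bullet> \<sigma> y"
      using assms(2) by (simp add: orthogonal_transformation_def)
    then show ?thesis using assms(3) by (metis comp_apply id_apply)
  qed
  have "vbracket (deform \<sigma> J) X Y \<bullet> Z = vbracket J X (\<sigma> Y) \<bullet> Z" for Z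
    by (simp only: inner_vbracket[OF B] inner_vbracket[OF assms(1)]) (simp add: deform_def sym)
  then show "vbracket (deform \<sigma> J) X Y = vbracket J X (\<sigma> Y)"
    by (metis vector_eq_rdot)
qed

lemma metric_two_step_nilpotent_deform:
  assumes "metric_two_step_nilpotent J"
    and "orthogonal_transformation \<sigma>" and inv: "\<sigma> \<circ> \<sigma> = id"
    and comm: "\<And>Z. \<sigma> \<circ> J Z = J Z \<circ> \<sigma>"
  shows "metric_two_step_nilpotent (deform \<sigma> J)"
proof -
  have J: "bilinear J" and skew: "\<And>Z X Y. J Z X \<bullet> Y = - (X \<bullet> J Z Y)" and "inj J"
    and centre: "{n. \<forall>m. nbracket J n m = 0} = {0} \<times> UNIV"
    and derived: "span {nbracket J m n | m n. True} = {0} \<times> UNIV"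
    using assms(1) by (auto simp: metric_two_step_nilpotent_def)
  note V = vbracket_deform[OF J assms(2) inv]
  have inv': "\<sigma> (\<sigma> x) = x" for x using inv by (metis comp_apply id_apply)
  have N: "nbracket (deform \<sigma> J) m n = nbracket J m (\<sigma> (fst n), snd n)" for m n
    by (simp add: nbracket_def V(2))
  have N': "nbracket J m n = nbracket (deform \<sigma> J) m (\<sigma> (fst n), snd n)" for m n
    by (simp add: N inv')
  have iso: "\<sigma> x \<bullet> \<sigma> y = x \<bullet> y" for x y
    using assms(2) by (simp add: orthogonal_transformation_def)
  have "deform \<sigma> J Z X \<bullet> Y = - (X \<bullet> deform \<sigma> J Z Y)" for Z X Y
  proof -
    have "deform \<sigma> J Z X \<bullet> Y = J Z (\<sigma> X) \<bullet> Y"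
      using comm[of Z] by (simp add: deform_def fun_eq_iff)
    also have "\<dots> = - (\<sigma> X \<bullet> J Z Y)" by (rule skew)
    also have "\<sigma> X \<bullet> J Z Y = X \<bullet> \<sigma> (J Z Y)" using iso[of X "\<sigma> (J Z Y)"] by (simp add: inv')
    finally show ?thesis by (simp add: deform_def)
  qed
  moreover have "inj (deform \<sigma> J)"
  proof (rule injI)
    fix Z Z' assume "deform \<sigma> J Z = deform \<sigma> J Z'"
    then have "J Z X = J Z' X" for X
      by (metis comp_apply deform_def inv')
    then show "Z = Z'" using \<open>inj J\<close> by (auto dest: injD)
  qed
  moreover have "{n. \<forall>m. nbracket (deform \<sigma> J) n m = 0} = {n. \<forall>m. nbracket J n m = 0}"
    using N N' by metis
  moreover have "{nbracket (deform \<sigma> J) m n | m n. True} = {nbracket J m n | m n. True}"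
    using N N' by metis
  ultimately show ?thesis
    using V(1) centre derived by (simp add: metric_two_step_nilpotent_def)
qed

end

theory Submission
  imports Defs
begin

text \<open>
  The Ricci tensor at the origin depends on \<open>J\<close> only through inner products of vectors of the
  form \<open>J\<^sub>Z X\<close>:
  \<open>Ric(m, n) = 1/4 \<Sum>\<^sub>e \<langle>J\<^sub>m\<^sub>z e, J\<^sub>n\<^sub>z e\<rangle> - 1/2 \<Sum>\<^sub>f \<langle>J\<^sub>f m\<^sub>v, J\<^sub>f n\<^sub>v\<rangle>\<close>, where \<open>e\<close> and \<open>f\<close> run
  through orthonormal bases of \<open>v\<close> and \<open>z\<close> and the subscripts of \<open>m\<close>, \<open>n\<close> denote components
  (\<open>ricci_origin\<close>).  Since \<open>\<sigma>\<close> is an isometry, replacing every \<open>J\<^sub>Z\<close> by \<open>\<sigma> J\<^sub>Z\<close> does not change these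
  inner products.  That \<open>\<sigma>\<close> is an involution commuting with the \<open>J\<^sub>Z\<close> is what makes the
  operators \<open>\<sigma> J\<^sub>Z\<close> skew again, so that the formula applies to the deformed algebra too.

  The formula is obtained in the global chart \<open>v \<oplus> z\<close>.  The Christoffel symbols are
  polynomial in the base point (\<open>christoffel_left_invariant_metric\<close>), so that the curvature
  tensor at the origin is explicit.  In its trace, the directions in \<open>v\<close> contribute the first
  sum of the formula and \<open>- 3/4 \<Sum>\<^sub>e \<langle>[m\<^sub>v, e], [n\<^sub>v, e]\<rangle>\<close>.  Expanding each bracket in
  the basis \<open>f\<close> turns the latter into \<open>- 3/4 \<Sum>\<^sub>f \<langle>J\<^sub>f m\<^sub>v, J\<^sub>f n\<^sub>v\<rangle>\<close>
  (\<open>sum_inner_vbracket\<close>).  The directions in \<open>z\<close> contribute the same sum with factor \<open>1/4\<close>.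
\<close>

text \<open>
  The \<open>z\<close>-component of the left-invariant Maurer--Cartan form: \<open>(fst u, vertical_form J p u)\<close> is
  the tangent vector \<open>u\<close> at \<open>p\<close> moved back to the origin.
\<close>

definition vertical_form ::
    "('z::euclidean_space \<Rightarrow> 'v::euclidean_space \<Rightarrow> 'v) \<Rightarrow> 'v \<times> 'z \<Rightarrow> 'v \<times> 'z \<Rightarrow> 'z" where
  "vertical_form J p u = snd u - (1/2) *\<^sub>R vbracket J (fst p) (fst u)"

lemma left_invariant_metric_vertical_form:
  assumes "bilinear J"
  shows "left_invariant_metric J p u w =
     fst u \<bullet> fst w + vertical_form J p u \<bullet> vertical_form J p w"
  by (simp add: left_invariant_metric_eq[OF assms] vertical_form_def)

lemma vertical_form_has_derivative:
  assumes "bilinear J"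
  shows "((\<lambda>q. vertical_form J q u) has_derivative
           (\<lambda>a. - ((1/2) *\<^sub>R vbracket J (fst a) (fst u)))) (at p)"
proof -
  have "bounded_linear (\<lambda>x. vbracket J x (fst u))"
    using bilinear_vbracket[OF assms] by (simp add: bilinear_def linear_conv_bounded_linear)
  then have "((\<lambda>q. vbracket J (fst q) (fst u)) has_derivative
          (\<lambda>a. vbracket J (fst a) (fst u))) (at p)"
    by (rule bounded_linear.has_derivative) (auto intro!: derivative_eq_intros)
  then show ?thesis
    unfolding vertical_form_def by (auto intro!: derivative_eq_intros)
qed

lemma frechet_derivative_left_invariant_metric:
  assumes "bilinear J"
  shows "frechet_derivative (\<lambda>q. left_invariant_metric J q u w) (at p) a =
     - (vbracket J (fst a) (fst u) \<bullet> vertical_form J p w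
        + vbracket J (fst a) (fst w) \<bullet> vertical_form J p u) / 2"
proof -
  have "((\<lambda>q. left_invariant_metric J q u w) has_derivative
     (\<lambda>a. - (vbracket J (fst a) (fst u) \<bullet> vertical_form J p w
        + vbracket J (fst a) (fst w) \<bullet> vertical_form J p u) / 2)) (at p)"
    unfolding left_invariant_metric_vertical_form[OF assms]
    by (auto intro!: derivative_eq_intros vertical_form_has_derivative[OF assms]
        simp: fun_eq_iff inner_commute algebra_simps add_divide_distrib diff_divide_distrib)
  from fun_cong[OF frechet_derivative_at[OF this], of a] show ?thesis by simp
qed

text \<open>
  A metric being positive definite, a vector is determined by its products with all vectors; this
  is the uniqueness behind the definite description in the Christoffel symbols.
\<close>

lemma left_invariant_metric_nondegenerate:
  assumes J: "bilinear J"
    and eq: "\<And>y. left_invariant_metric J p x y = left_invariant_metric J p x' y"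
  shows "x = x'"
proof -
  note B = bilinear_vbracket[OF J]
  define d where "d = x - x'"
  have "vertical_form J p d = vertical_form J p x - vertical_form J p x'"
    by (simp add: d_def vertical_form_def bilinear_rsub[OF B] algebra_simps)
  then have "vertical_form J p d \<bullet> vertical_form J p d =
      vertical_form J p x \<bullet> vertical_form J p d - vertical_form J p x' \<bullet> vertical_form J p d"
    by (simp add: inner_diff_left)
  moreover have "fst d \<bullet> fst d = fst x \<bullet> fst d - fst x' \<bullet> fst d"
    by (simp add: d_def inner_diff_left)
  ultimately have "fst d \<bullet> fst d + vertical_form J p d \<bullet> vertical_form J p d = 0"
    using eq[of d] by (simp add: left_invariant_metric_vertical_form[OF J])
  then have "fst d = 0" and "vertical_form J p d = 0"
    by (simp_all add: add_nonneg_eq_0_iff)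
  moreover from this have "snd d = 0"
    using bilinear_rzero[OF B] by (simp add: vertical_form_def)
  ultimately have "d = 0" by (simp add: prod_eq_iff)
  then show ?thesis by (simp add: d_def)
qed

text \<open>
  The derivative terms with a bracket of \<open>u\<close> and \<open>w\<close> cancel by antisymmetry, and what
  remains depends on the test vector \<open>y\<close> only through its \<open>v\<close>-component.  Hence the Christoffel
  symbol is horizontal: its \<open>z\<close>-component is the one that makes \<open>vertical_form\<close> vanish.
\<close>

lemma christoffel_left_invariant_metric:
  assumes n: "metric_two_step_nilpotent J"
  defines "G \<equiv> \<lambda>p u w. - (1/2) *\<^sub>R (J (vertical_form J p w) (fst u) + J (vertical_form J p u) (fst w))"
  shows "christoffel (left_invariant_metric J) p u w =
     (G p u w, (1/2) *\<^sub>R vbracket J (fst p) (G p u w))"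
    (is "_ = ?C")
proof -
  have J: "bilinear J" using n by (simp add: metric_two_step_nilpotent_def)
  have vert: "vertical_form J p ?C = 0" by (simp add: vertical_form_def)
  have C: "left_invariant_metric J p ?C y =
     (frechet_derivative (\<lambda>q. left_invariant_metric J q w y) (at p) u
      + frechet_derivative (\<lambda>q. left_invariant_metric J q u y) (at p) w
      - frechet_derivative (\<lambda>q. left_invariant_metric J q u w) (at p) y) / 2" for y
    unfolding frechet_derivative_left_invariant_metric[OF J]
    unfolding left_invariant_metric_vertical_form[OF J] vert
    using vbracket_antisym[OF n, of "fst w" "fst u"] vbracket_antisym[OF n, of "fst y" "fst u"]
      vbracket_antisym[OF n, of "fst y" "fst w"]
    by (simp add: inner_vbracket[OF J] G_def inner_add_left inner_diff_left field_simps)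
  show ?thesis
    unfolding christoffel_def
  proof (rule the_equality)
    show "x = ?C" if "\<forall>y. left_invariant_metric J p x y =
     (frechet_derivative (\<lambda>q. left_invariant_metric J q w y) (at p) u
      + frechet_derivative (\<lambda>q. left_invariant_metric J q u y) (at p) w
      - frechet_derivative (\<lambda>q. left_invariant_metric J q u w) (at p) y) / 2" for x
      by (rule left_invariant_metric_nondegenerate[OF J, of p]) (simp only: that C)
  qed (use C in blast)
qed

text \<open>
  The \<open>z\<close>-component of the Christoffel symbol is half the bracket of the base point with the
  \<open>v\<close>-component.  By the product rule, its derivative at the origin involves only the value of
  that \<open>v\<close>-component there.
\<close>

lemma frechet_derivative_christoffel_origin:
  fixes J :: "'z::euclidean_space \<Rightarrow> 'v::euclidean_space \<Rightarrow> 'v"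
  assumes n: "metric_two_step_nilpotent J"
  shows "frechet_derivative (\<lambda>p. christoffel (left_invariant_metric J) p v w) (at 0) u =
     ((1/4) *\<^sub>R (J (vbracket J (fst u) (fst w)) (fst v) + J (vbracket J (fst u) (fst v)) (fst w)),
      - (1/4) *\<^sub>R vbracket J (fst u) (J (snd w) (fst v) + J (snd v) (fst w)))"
proof -
  have J: "bilinear J" using n by (simp add: metric_two_step_nilpotent_def)
  note B = bilinear_vbracket[OF J]
  have bb: "bounded_bilinear (vbracket J)"
    using B by (simp add: bilinear_conv_bounded_bilinear)
  have D1: "((\<lambda>p. J (vertical_form J p a) x) has_derivative
      (\<lambda>u. J (- ((1/2) *\<^sub>R vbracket J (fst u) (fst a))) x)) (at 0)" for a x
  proof -
    have "bounded_linear (\<lambda>Z. J Z x)"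
      using J by (simp add: bilinear_def linear_conv_bounded_linear)
    then show ?thesis
      by (rule bounded_linear.has_derivative) (rule vertical_form_has_derivative[OF J])
  qed
  define G where
    "G p = - (1/2) *\<^sub>R (J (vertical_form J p w) (fst v) + J (vertical_form J p v) (fst w))" for p
  define G' where
    "G' u = (1/4) *\<^sub>R (J (vbracket J (fst u) (fst w)) (fst v) + J (vbracket J (fst u) (fst v)) (fst w))"
    for u :: "'v \<times> 'z"
  have DG: "(G has_derivative G') (at 0)"
    unfolding G_def G'_def
    by (rule derivative_eq_intros D1 refl ext)+
      (simp add: bilinear_lneg[OF J] bilinear_lmul[OF J] fun_eq_iff algebra_simps)
  have "((\<lambda>p. vbracket J (fst p) (G p)) has_derivative
      (\<lambda>u. vbracket J (fst (0 :: 'v \<times> 'z)) (G' u) + vbracket J (fst u) (G 0))) (at 0)"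
    by (rule bounded_bilinear.FDERIV[OF bb has_derivative_fst[OF has_derivative_ident] DG])
  then have "((\<lambda>p. vbracket J (fst p) (G p)) has_derivative (\<lambda>u. vbracket J (fst u) (G 0))) (at 0)"
    by (simp add: bilinear_lzero[OF B])
  then have "((\<lambda>p. (G p, (1/2) *\<^sub>R vbracket J (fst p) (G p))) has_derivative
      (\<lambda>u. (G' u, (1/2) *\<^sub>R vbracket J (fst u) (G 0)))) (at 0)"
    by (intro has_derivative_Pair DG has_derivative_scaleR_right)
  from fun_cong[OF frechet_derivative_at[OF this], of u] show ?thesis
    unfolding christoffel_left_invariant_metric[OF n] G_def G'_def
    by (simp add: vertical_form_def bilinear_lzero[OF B] bilinear_rneg[OF B] bilinear_rmul[OF B])
qed

lemma christoffel_origin: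
  assumes n: "metric_two_step_nilpotent J"
  shows "christoffel (left_invariant_metric J) 0 u w =
     (- (1/2) *\<^sub>R (J (snd w) (fst u) + J (snd u) (fst w)), 0)"
proof -
  have J: "bilinear J" using n by (simp add: metric_two_step_nilpotent_def)
  show ?thesis
    using bilinear_lzero[OF bilinear_vbracket[OF J]]
    by (simp add: christoffel_left_invariant_metric[OF n] vertical_form_def)
qed

lemma levi_civita_twice_origin:
  assumes n: "metric_two_step_nilpotent J"
  shows "levi_civita (left_invariant_metric J) (\<lambda>_. u)
           (levi_civita (left_invariant_metric J) (\<lambda>_. v) (\<lambda>_. w)) 0 =
     ((1/4) *\<^sub>R (J (vbracket J (fst u) (fst w)) (fst v) + J (vbracket J (fst u) (fst v)) (fst w)
        + J (snd u) (J (snd w) (fst v) + J (snd v) (fst w))),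
      - (1/4) *\<^sub>R vbracket J (fst u) (J (snd w) (fst v) + J (snd v) (fst w)))"
proof -
  have J: "bilinear J" using n by (simp add: metric_two_step_nilpotent_def)
  have "levi_civita (left_invariant_metric J) (\<lambda>_. v) (\<lambda>_. w) =
      (\<lambda>p. christoffel (left_invariant_metric J) p v w)"
    by (simp add: levi_civita_def fun_eq_iff)
  then show ?thesis
    unfolding levi_civita_def
    by (simp add: frechet_derivative_christoffel_origin[OF n] christoffel_origin[OF n]
        bilinear_lzero[OF J] bilinear_rneg[OF J] bilinear_rmul[OF J] bilinear_radd[OF J]
        bilinear_rsub[OF J] algebra_simps)
qed

text \<open>
  Both sides are \<open>\<Sum>\<^sub>e \<Sum>\<^sub>f \<langle>J\<^sub>f X, e\<rangle> \<langle>J\<^sub>f Y, e\<rangle>\<close>, by Parseval's identity in \<open>z\<close> and in \<open>v\<close>.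
\<close>

lemma sum_inner_vbracket:
  assumes "bilinear J"
  shows "(\<Sum>e\<in>Basis. vbracket J X e \<bullet> vbracket J Y e) = (\<Sum>f\<in>Basis. J f X \<bullet> J f Y)"
proof -
  have "(\<Sum>e\<in>Basis. vbracket J X e \<bullet> vbracket J Y e) =
      (\<Sum>e\<in>Basis. \<Sum>f\<in>Basis. (J f X \<bullet> e) * (J f Y \<bullet> e))"
    by (subst euclidean_inner) (simp add: inner_vbracket[OF assms])
  also have "\<dots> = (\<Sum>f\<in>Basis. J f X \<bullet> J f Y)"
    by (subst sum.swap) (simp flip: euclidean_inner)
  finally show ?thesis .
qed

text \<open>
  The trace splits over the bases of \<open>v\<close> and \<open>z\<close>.  For a direction \<open>e\<close> in \<open>v\<close> the curvature
  term \<open>J\<^sub>[\<^sub>v\<^sub>,\<^sub>w\<^sub>] e\<close> drops out because it is orthogonal to \<open>e\<close>; skewness moves one factor of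
  the term \<open>J\<^sub>Z J\<^sub>W e\<close> onto \<open>e\<close>, and the defining property of the bracket turns the other two terms
  into products of brackets.
\<close>

lemma ricci_origin:
  assumes n: "metric_two_step_nilpotent J"
  shows "ricci (left_invariant_metric J) 0 v w =
     (\<Sum>e\<in>Basis. J (snd v) e \<bullet> J (snd w) e) / 4 - (\<Sum>f\<in>Basis. J f (fst v) \<bullet> J f (fst w)) / 2"
proof -
  have J: "bilinear J" and skew: "J Z X \<bullet> Y = - (X \<bullet> J Z Y)" for Z X Y
    using n by (auto simp: metric_two_step_nilpotent_def)
  note B = bilinear_vbracket[OF J]
  note R = riemann_curvature_def levi_civita_twice_origin[OF n]
  have skew0: "J Z X \<bullet> X = 0" for Z X
    using skew[of Z X X] by (simp add: inner_commute)
  have horizontal: "riemann_curvature (left_invariant_metric J) 0 (e, 0) v w \<bullet> (e, 0) =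
      (J (snd v) e \<bullet> J (snd w) e) / 4
      - 3 / 4 * (vbracket J (fst v) e \<bullet> vbracket J (fst w) e)" for e
  proof -
    have "J (vbracket J X Y) X' \<bullet> e = vbracket J X' e \<bullet> vbracket J X Y" for X Y X'
      by (simp add: inner_vbracket[OF J])
    then have "J (vbracket J e (fst w)) (fst v) \<bullet> e = - (vbracket J (fst v) e \<bullet> vbracket J (fst w) e)"
      "J (vbracket J e (fst v)) (fst w) \<bullet> e = - (vbracket J (fst v) e \<bullet> vbracket J (fst w) e)"
      "J (vbracket J (fst v) e) (fst w) \<bullet> e = vbracket J (fst v) e \<bullet> vbracket J (fst w) e"
      using vbracket_antisym[OF n, of e "fst v"] vbracket_antisym[OF n, of e "fst w"]
      by (simp_all add: bilinear_lneg[OF J] inner_commute)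
    moreover have "J (snd v) (J (snd w) e) \<bullet> e = - (J (snd v) e \<bullet> J (snd w) e)"
      using skew[of "snd v" "J (snd w) e" e] by (simp add: inner_commute)
    ultimately show ?thesis
      by (simp add: R inner_prod_def bilinear_lzero[OF J] skew0 algebra_simps)
  qed
  have vertical: "riemann_curvature (left_invariant_metric J) 0 (0, f) v w \<bullet> (0, f) =
      (J f (fst v) \<bullet> J f (fst w)) / 4" for f
    by (simp add: R inner_prod_def bilinear_lzero[OF B] bilinear_rzero[OF J] inner_vbracket[OF J])
  have "ricci (left_invariant_metric J) 0 v w =
      (\<Sum>e\<in>Basis. riemann_curvature (left_invariant_metric J) 0 (e, 0) v w \<bullet> (e, 0))
      + (\<Sum>f\<in>Basis. riemann_curvature (left_invariant_metric J) 0 (0, f) v w \<bullet> (0, f))"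
    unfolding ricci_def Basis_prod_def
    by (subst sum.union_disjoint) (auto simp: sum.reindex inj_on_def)
  then show ?thesis
    by (simp add: horizontal vertical sum_subtractf sum_inner_vbracket[OF J]
        flip: sum_divide_distrib sum_distrib_left)
qed

theorem proposition5p3:
  fixes J :: "'z::euclidean_space \<Rightarrow> 'v::euclidean_space \<Rightarrow> 'v"
    and \<sigma> :: "'v \<Rightarrow> 'v"
  assumes "metric_two_step_nilpotent J"
    and "orthogonal_transformation \<sigma>"
    and "\<sigma> \<circ> \<sigma> = id"
    and "\<And>Z. \<sigma> \<circ> J Z = J Z \<circ> \<sigma>"
  shows "ricci (left_invariant_metric J) 0 = ricci (left_invariant_metric (deform \<sigma> J)) 0"
proof (intro ext)
  fix v w
  have "deform \<sigma> J Z X \<bullet> deform \<sigma> J Z' Y = J Z X \<bullet> J Z' Y" for Z Z' X Y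
    using assms(2) by (simp add: deform_def orthogonal_transformation_def)
  then show "ricci (left_invariant_metric J) 0 v w =
      ricci (left_invariant_metric (deform \<sigma> J)) 0 v w"
    by (simp add: ricci_origin[OF assms(1)]
        ricci_origin[OF metric_two_step_nilpotent_deform[OF assms]])
qed

end
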